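(* Let $a,b,c,d\in\mathbb{R}$, let $n\ge 1$ be an integer, and let $A_k^n\in\mathbb{R}_{\max}^{2\times 2}$ be the state decision matrices of the max-plus walk with weights $P=\begin{bmatrix} a & b\\ \varepsilon & \varepsilon\end{bmatrix}$ and $Q=\begin{bmatrix}\varepsilon & \varepsilon\\ c & d\end{bmatrix}$ (as defined in the context). Put $R=\begin{bmatrix} c & d\\ \varepsilon & \varepsilon\end{bmatrix}$ and $S=\begin{bmatrix}\varepsilon & \varepsilon\\ a & b\end{bmatrix}$. For $k=-n$ and $k=n$, $$A_{-n}^{n}=(n-1)a\otimes P,\qquad A_{n}^{n}=(n-1)d\otimes Q.$$ For $k=-n+2,-n+4,\dots,n-4,n-2$, writing $\ell=\frac{n-k}{2}$ and $m=\frac{n+k}{2}$ (the numbers of moves to the left and to the right during $n$ steps), $$\begin{aligned} A_k^{n} ={}& \bigoplus_{r=1}^{(\ell-1)\wedge m}\left\{(\ell-r-1)a+rb+rc+(m-r)d\right\}\otimes P\\ &\oplus\bigoplus_{r=1}^{\ell\wedge(m-1)}\left\{(\ell-r)a+rb+rc+(m-r-1)d\right\}\otimes Q\\ &\oplus\bigoplus_{r=1}^{\ell\wedge m}\left\{(\ell-r)a+rb+(r-1)c+(m-r)d\right\}\otimes R\\ &\oplus\bigoplus_{r=1}^{\ell\wedge m}\left\{(\ell-r)a+(r-1)b+rc+(m-r)d\right\}\otimes S, \end{aligned}$$ where $x\wedge y=\min\{x,y\}$.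
   Context: Max-plus algebra: $\mathbb{R}_{\max}=\mathbb{R}\cup\{-\infty\}$ with $x\oplus y=\max\{x,y\}$ and $x\otimes y=x+y$; write $\varepsilon=-\infty$ (neutral for $\oplus$, absorbing for $\otimes$) and $e=0$ (neutral for $\otimes$). Matrix operations are $[A\oplus B]_{ij}=[A]_{ij}\oplus[B]_{ij}$, $[A\otimes B]_{ij}=\bigoplus_k [A]_{ik}\otimes[B]_{kj}$, and for a scalar $\alpha$, $[\alpha\otimes A]_{ij}=\alpha\otimes[A]_{ij}$. Expressions such as $(n-1)a$ or $(\ell-r)a+rb$ inside scalars use ordinary real multiplication and addition. An empty $\bigoplus$ of matrices is the matrix with all entries $\varepsilon$. Max-plus walk on $\mathbb{Z}$: vectors $\psi_k^n\in\mathbb{R}_{\max}^2$ ($k\in\mathbb{Z}$, $n\ge 0$) evolve by $\psi_k^n=(P\otimes\psi_{k+1}^{n-1})\oplus(Q\otimes\psi_{k-1}^{n-1})$, with initial state supported at position $0$ (i.e. $\psi_k^0=(\varepsilon,\varepsilon)^\top$ for $k\neq 0$). The state decision matrix $A_k^n$ is the matrix with $\psi_k^n=A_k^n\otimes\psi_0^0$ for every initial $\psi_0^0$. Equivalently, $A_0^0$ is the max-plus identity matrix (diagonal entries $e$, off-diagonal entries $\varepsilon$), $A_k^0$ has all entries $\varepsilon$ for $k\ne0$, and $A_k^n=(P\otimes A_{k+1}^{n-1})\oplus(Q\otimes A_{k-1}^{n-1})$ for $n\ge1$; that is, for $k\in\{-n,-n+2,\dots,n\}$, $A_k^n$ is the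 $\oplus$-sum of all products $M_n\otimes\cdots\otimes M_1$ with $M_i\in\{P,Q\}$ in which $P$ occurs exactly $\ell=(n-k)/2$ times and $Q$ exactly $m=(n+k)/2$ times. *)

theory Defs
  imports "HOL-Analysis.Analysis"
begin

text \<open>
  The max-plus semiring, as an instance of \<^class>\<open>comm_semiring_1\<close>: \<open>+\<close> is the maximum, \<open>*\<close> is
  addition of reals, \<open>0\<close> is \<open>-\<infinity>\<close> (written \<open>\<epsilon>\<close>), and \<open>1\<close> is \<open>e\<close>, the real number 0. With this instance
  the operations \<open>+\<close>, \<open>\<Sum>\<close>, \<open>**\<close>, \<open>*v\<close> and \<open>mat 1\<close> of the library, at matrices over \<open>rmax\<close>, are the
  max-plus ones, and an empty \<open>\<Sum>\<close> of matrices has all entries \<open>\<epsilon>\<close>.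
\<close>

datatype rmax = NegInf (\<open>\<epsilon>\<close>) | Fin real

instantiation rmax :: comm_semiring_1
begin

definition zero_rmax :: rmax where
  "0 = \<epsilon>"

definition one_rmax :: rmax where
  "1 = Fin 0"

fun plus_rmax :: "rmax \<Rightarrow> rmax \<Rightarrow> rmax" where
  "\<epsilon> + y = y"
| "x + \<epsilon> = x"
| "Fin x + Fin y = Fin (max x y)"

fun times_rmax :: "rmax \<Rightarrow> rmax \<Rightarrow> rmax" where
  "\<epsilon> * y = \<epsilon>"
| "x * \<epsilon> = \<epsilon>"
| "Fin x * Fin y = Fin (x + y)"

instance
proof
  fix x y z :: rmax
  show "x + y + z = x + (y + z)" by (cases x; cases y; cases z) auto
  show "x + y = y + x" by (cases x; cases y) auto
  show "0 + x = x" by (simp add: zero_rmax_def)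
  show "x * y * z = x * (y * z)" by (cases x; cases y; cases z) auto
  show "x * y = y * x" by (cases x; cases y) auto
  show "1 * x = x" by (cases x) (auto simp: one_rmax_def)
  show "(x + y) * z = x * z + y * z" by (cases x; cases y; cases z) auto
  show "0 * x = 0" by (simp add: zero_rmax_def)
  show "x * 0 = 0" by (cases x) (auto simp: zero_rmax_def)
  show "(0::rmax) \<noteq> 1" by (simp add: zero_rmax_def one_rmax_def)
qed

end

definition mat_scale :: "rmax \<Rightarrow> rmax ^ 'n ^ 'm \<Rightarrow> rmax ^ 'n ^ 'm" (infixr \<open>\<otimes>\<^sub>m\<close> 72) where
  "\<alpha> \<otimes>\<^sub>m A = (\<chi> i j. \<alpha> * A $ i $ j)"

primrec walk :: "rmax ^ 2 ^ 2 \<Rightarrow> rmax ^ 2 ^ 2 \<Rightarrow> rmax ^ 2 \<Rightarrow> nat \<Rightarrow> int \<Rightarrow> rmax ^ 2" where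
  "walk P Q v 0 k = (if k = 0 then v else 0)"
| "walk P Q v (Suc n) k = P *v walk P Q v n (k + 1) + Q *v walk P Q v n (k - 1)"

primrec decision :: "rmax ^ 2 ^ 2 \<Rightarrow> rmax ^ 2 ^ 2 \<Rightarrow> nat \<Rightarrow> int \<Rightarrow> rmax ^ 2 ^ 2" where
  "decision P Q 0 k = (if k = 0 then mat 1 else 0)"
| "decision P Q (Suc n) k = P ** decision P Q n (k + 1) + Q ** decision P Q n (k - 1)"

lemma walk_eq_decision: "walk P Q v n k = decision P Q n k *v v"
  by (induction n arbitrary: k)
     (simp_all add: matrix_vector_mul_assoc matrix_vector_mult_add_rdistrib)

text \<open>\<^const>\<open>decision\<close> is determined by the evolution of the walk:\<close>

lemma decision_unique:
  "A = decision P Q n k \<longleftrightarrow> (\<forall>v. walk P Q v n k = A *v v)"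
  by (auto simp: walk_eq_decision matrix_eq)

end

theory Submission
  imports Defs
begin

text \<open>
  All matrices involved have one row equal to \<open>\<epsilon>\<close>, and multiplying such a matrix from the left by
  \<open>P\<close> or \<open>Q\<close> only moves its other row and scales it. So the span of \<open>P, Q, R, S\<close> is stable, and
  the recursion of the walk becomes a scalar recursion for the four coefficients: the \<open>P\<close> and \<open>R\<close>
  parts come from a last step to the left, the \<open>Q\<close> and \<open>S\<close> parts from a last step to the right.
  Exchanging left and right swaps \<open>(a, b)\<close> with \<open>(d, c)\<close> and \<open>\<ell>\<close> with \<open>m\<close>, which turns the
  coefficients of \<open>P\<close> and \<open>R\<close> into those of \<open>Q\<close> and \<open>S\<close>. Since \<open>max\<close> is idempotent, the scalar
  recursion holds as soon as the index ranges on its right-hand side cover the one on the left.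
\<close>

section \<open>Idempotent sums and scalar multiples of matrices\<close>

lemma rmax_add_idem [simp]: "x + x = (x::rmax)"
  by (cases x) auto

text \<open>Idempotence takes the place of disjointness: a term indexed by both sets is counted
  twice on the right, and the second copy is absorbed.\<close>

lemma sum_rmax_Un:
  fixes f :: "'a \<Rightarrow> rmax"
  assumes "finite A" "finite B"
  shows "sum f (A \<union> B) = sum f A + sum f B"
  using assms(1)
proof (induction A rule: finite_induct)
  case empty
  show ?case by simp
next
  case (insert x A)
  show ?case
  proof (cases "x \<in> B")
    case True
    have "sum f B = f x + sum f B"
      using True assms(2) by (simp add: sum.remove flip: add.assoc)
    then have "f x + (sum f A + sum f B) = sum f A + sum f B"
      by (metis add.left_commute)
    moreover have "insert x A \<union> B = A \<union> B"
      using True by blast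
    ultimately show ?thesis
      using insert by (simp add: add.assoc)
  next
    case False
    then show ?thesis
      using insert assms(2) by (simp add: add.assoc)
  qed
qed

lemma mat_scale_simps [simp]:
  "1 \<otimes>\<^sub>m A = A" "0 \<otimes>\<^sub>m A = 0"
  "x \<otimes>\<^sub>m y \<otimes>\<^sub>m A = (x * y) \<otimes>\<^sub>m A"
  by (simp_all add: mat_scale_def vec_eq_iff mult.assoc)

lemma mat_scale_add_left: "(x + y) \<otimes>\<^sub>m A = x \<otimes>\<^sub>m A + y \<otimes>\<^sub>m A"
  by (simp add: mat_scale_def vec_eq_iff distrib_right)

lemma mat_scale_sum_left: "sum f I \<otimes>\<^sub>m A = (\<Sum>r\<in>I. f r \<otimes>\<^sub>m A)"
  by (induction I rule: infinite_finite_induct) (simp_all add: mat_scale_add_left)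

lemma matrix_mult_mat_scale: "A ** (x \<otimes>\<^sub>m B) = x \<otimes>\<^sub>m (A ** B)"
  by (simp add: mat_scale_def matrix_matrix_mult_def vec_eq_iff sum_distrib_left mult.left_commute)

section \<open>One-row matrices and the coefficients of the expansion\<close>

definition top_row :: "rmax \<Rightarrow> rmax \<Rightarrow> rmax ^ 2 ^ 2" where
  "top_row x y = vector [vector [x, y], vector [\<epsilon>, \<epsilon>]]"

definition bottom_row :: "rmax \<Rightarrow> rmax \<Rightarrow> rmax ^ 2 ^ 2" where
  "bottom_row x y = vector [vector [\<epsilon>, \<epsilon>], vector [x, y]]"

text \<open>The left factor fixes the position of the row, the right factor its entries. In the
  notation of the theorem, \<open>P\<close> sends P, S, R, Q to aP, bP, aR, bR, and \<open>Q\<close>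
  sends Q, R, S, P to dQ, cQ, dS, cS.\<close>

lemma row_mult:
  "top_row x y ** top_row u v = x \<otimes>\<^sub>m top_row u v"
  "top_row x y ** bottom_row u v = y \<otimes>\<^sub>m top_row u v"
  "bottom_row x y ** top_row u v = x \<otimes>\<^sub>m bottom_row u v"
  "bottom_row x y ** bottom_row u v = y \<otimes>\<^sub>m bottom_row u v"
  by (simp_all add: top_row_def bottom_row_def mat_scale_def matrix_matrix_mult_def vec_eq_iff
      forall_2 sum_2 flip: zero_rmax_def)

text \<open>In a product of \<open>l\<close> factors P and \<open>m\<close> factors Q, read as a
  word, the adjacent pairs PP, PQ, QP, QQ contribute a, b, c, d. This is the maximum over words that
  begin and end with P; \<open>r\<close> is the number of blocks of Q.\<close>

definition coeff_P :: "real \<Rightarrow> real \<Rightarrow> real \<Rightarrow> real \<Rightarrow> int \<Rightarrow> int \<Rightarrow> rmax" where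
  "coeff_P a b c d l m = (\<Sum>r = 1..min (l - 1) m.
     Fin (of_int (l - r - 1) * a + of_int r * b + of_int r * c + of_int (m - r) * d))"

text \<open>The maximum over words from P to Q with \<open>r\<close> blocks of each letter, hence
  with one pair QP fewer than PQ.\<close>

definition coeff_R :: "real \<Rightarrow> real \<Rightarrow> real \<Rightarrow> real \<Rightarrow> int \<Rightarrow> int \<Rightarrow> rmax" where
  "coeff_R a b c d l m = (\<Sum>r = 1..min l m.
     Fin (of_int (l - r) * a + of_int r * b + of_int (r - 1) * c + of_int (m - r) * d))"

text \<open>\<open>coeff_R d c b a m l\<close> belongs to words from Q to P. Prepending P never
  changes the number of blocks of Q, so both terms on the right get the same summand
  \<open>?f\<close>, and only their ranges have to be united.\<close>

lemma coeff_P_rec: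
  shows "coeff_P a b c d (l + 1) m = Fin a * coeff_P a b c d l m + Fin b * coeff_R d c b a m l"
proof -
  let ?f = "\<lambda>r. Fin (of_int (l - r) * a + of_int r * b + of_int r * c + of_int (m - r) * d)"
  have "Fin a * coeff_P a b c d l m = sum ?f {1..min (l - 1) m}"
    unfolding coeff_P_def sum_distrib_left by (intro sum.cong) (auto simp: algebra_simps)
  moreover have "Fin b * coeff_R d c b a m l = sum ?f {1..min l m}"
    unfolding coeff_R_def sum_distrib_left
    by (intro sum.cong) (auto simp: algebra_simps min.commute)
  moreover have "coeff_P a b c d (l + 1) m = sum ?f ({1..min (l - 1) m} \<union> {1..min l m})"
    unfolding coeff_P_def by (intro sum.cong) auto
  ultimately show ?thesis
    by (simp add: sum_rmax_Un)
qed

lemma coeff_R_rec: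
  assumes "l \<ge> 1" "m \<ge> 1"
  shows "coeff_R a b c d (l + 1) m = Fin a * coeff_R a b c d l m + Fin b * coeff_P d c b a m l"
proof -
  let ?f = "\<lambda>r. Fin (of_int (l + 1 - r) * a + of_int r * b + of_int (r - 1) * c + of_int (m - r) * d)"
  have "Fin a * coeff_R a b c d l m = sum ?f {1..min l m}"
    unfolding coeff_R_def sum_distrib_left by (intro sum.cong) (auto simp: algebra_simps)
  \<comment> \<open>Prepending P to a word that begins with Q opens a new block of P:
    \<open>r\<close> shifts by one and starts at 2.\<close>
  moreover have "Fin b * coeff_P d c b a m l = sum ?f {2..min (l + 1) m}"
    unfolding coeff_P_def sum_distrib_left
    by (rule sum.reindex_bij_witness[of _ "\<lambda>r. r - 1" "\<lambda>r. r + 1"]) (auto simp: algebra_simps)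
  \<comment> \<open>The hypotheses put \<open>r = 1\<close>, which the second range misses, into the
    first.\<close>
  moreover have "coeff_R a b c d (l + 1) m = sum ?f ({1..min l m} \<union> {2..min (l + 1) m})"
    unfolding coeff_R_def using assms by (intro sum.cong) auto
  ultimately show ?thesis
    by (simp add: sum_rmax_Un)
qed

text \<open>Starting values of the recursions: with a single P the range of \<open>coeff_P\<close>
  is empty and that of \<open>coeff_R\<close> is \<open>r = 1\<close>. Mirrored, they serve for a
  single Q.\<close>

lemma coeff_one:
  assumes "m \<ge> 1"
  shows "coeff_P a b c d 1 m = 0" "coeff_R a b c d 1 m = Fin (b + of_int (m - 1) * d)"
  using assms by (simp_all add: coeff_P_def coeff_R_def)

section \<open>State decision matrices at the ends and in the interior\<close>

lemma decision_outside: "\<bar>k\<bar> > int n \<Longrightarrow> decision P Q n k = 0"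
  by (induction n arbitrary: k) (auto simp: matrix_matrix_mult_def vec_eq_iff)

text \<open>Only the word without Q reaches the left end; its \<open>Suc n\<close> letters form
  \<open>n\<close> pairs PP, each contributing a. The other branch vanishes by
  \<open>decision_outside\<close>.\<close>

lemma decision_left:
  "decision (top_row (Fin a) y) Q (Suc n) (- int (Suc n)) = Fin (real n * a) \<otimes>\<^sub>m top_row (Fin a) y"
proof (induction n)
  case 0
  show ?case
    by (simp add: decision_outside flip: one_rmax_def)
next
  case (Suc n)
  have "decision (top_row (Fin a) y) Q (Suc (Suc n)) (- int (Suc (Suc n))) =
      top_row (Fin a) y ** decision (top_row (Fin a) y) Q (Suc n) (- int (Suc n)) +
      Q ** decision (top_row (Fin a) y) Q (Suc n) (- int (Suc (Suc n)) - 1)"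
    by (subst decision.simps(2)) (simp add: algebra_simps del: decision.simps)
  also have "decision (top_row (Fin a) y) Q (Suc n) (- int (Suc (Suc n)) - 1) = 0"
    by (rule decision_outside) simp
  also note Suc.IH
  finally show ?case
    by (simp add: matrix_mult_mat_scale row_mult algebra_simps del: decision.simps)
qed

lemma decision_right:
  "decision P (bottom_row x (Fin d)) (Suc n) (int (Suc n)) = Fin (real n * d) \<otimes>\<^sub>m bottom_row x (Fin d)"
proof (induction n)
  case 0
  show ?case
    by (simp add: decision_outside flip: one_rmax_def)
next
  case (Suc n)
  have "decision P (bottom_row x (Fin d)) (Suc (Suc n)) (int (Suc (Suc n))) =
      P ** decision P (bottom_row x (Fin d)) (Suc n) (int (Suc (Suc n)) + 1) +
      bottom_row x (Fin d) ** decision P (bottom_row x (Fin d)) (Suc n) (int (Suc n))"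
    by (subst decision.simps(2)) (simp add: algebra_simps del: decision.simps)
  also have "decision P (bottom_row x (Fin d)) (Suc n) (int (Suc (Suc n)) + 1) = 0"
    by (rule decision_outside) simp
  also note Suc.IH
  finally show ?case
    by (simp add: matrix_mult_mat_scale row_mult algebra_simps del: decision.simps)
qed

text \<open>Here \<open>l\<close> and \<open>m\<close> are one less than the numbers of moves, so
  both kinds of move occur. Undoing the last step lowers \<open>l + m\<close> or leads to an end
  position.\<close>

lemma decision_interior:
  fixes a b c d :: real
  defines "P \<equiv> top_row (Fin a) (Fin b)" and "Q \<equiv> bottom_row (Fin c) (Fin d)"
    and "R \<equiv> top_row (Fin c) (Fin d)" and "S \<equiv> bottom_row (Fin a) (Fin b)"
  shows "decision P Q (Suc l + Suc m) (int m - int l) =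
    coeff_P a b c d (int l + 1) (int m + 1) \<otimes>\<^sub>m P + coeff_P d c b a (int m + 1) (int l + 1) \<otimes>\<^sub>m Q +
    coeff_R a b c d (int l + 1) (int m + 1) \<otimes>\<^sub>m R + coeff_R d c b a (int m + 1) (int l + 1) \<otimes>\<^sub>m S"
proof (induction "l + m" arbitrary: l m rule: less_induct)
  case less
  note mult = P_def Q_def R_def S_def row_mult matrix_mult_mat_scale matrix_add_ldistrib
  have P: "P ** decision P Q (Suc (l + m)) (int m - int l + 1) =
    coeff_P a b c d (int l + 1) (int m + 1) \<otimes>\<^sub>m P + coeff_R a b c d (int l + 1) (int m + 1) \<otimes>\<^sub>m R"
  proof (cases l)
    \<comment> \<open>The only move to the left is the last one, so the preceding matrix is a
      multiple of \<open>Q\<close>, and \<open>P ** Q\<close> contributes to the \<open>R\<close>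
      part alone.\<close>
    case 0
    then have "decision P Q (Suc (l + m)) (int m - int l + 1) = Fin (real m * d) \<otimes>\<^sub>m Q"
      using decision_right[of P "Fin c" d m] by (simp add: Q_def add.commute del: decision.simps)
    then show ?thesis
      using 0 by (simp add: mult coeff_one add.commute del: decision.simps)
  next
    case (Suc l')
    have "decision P Q (Suc (l + m)) (int m - int l + 1) = decision P Q (Suc l' + Suc m) (int m - int l')"
      by (simp add: Suc del: decision.simps)
    also have "\<dots> =
        coeff_P a b c d (int l' + 1) (int m + 1) \<otimes>\<^sub>m P + coeff_P d c b a (int m + 1) (int l' + 1) \<otimes>\<^sub>m Q +
        coeff_R a b c d (int l' + 1) (int m + 1) \<otimes>\<^sub>m R + coeff_R d c b a (int m + 1) (int l' + 1) \<otimes>\<^sub>m S"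
      by (rule less) (simp add: Suc)
    \<comment> \<open>The \<open>P\<close> part collects the images of \<open>P\<close> and
      \<open>S\<close>, the \<open>R\<close> part those of \<open>R\<close> and
      \<open>Q\<close>.\<close>
    moreover have "coeff_P a b c d (int l + 1) (int m + 1) =
        Fin a * coeff_P a b c d (int l' + 1) (int m + 1) +
        Fin b * coeff_R d c b a (int m + 1) (int l' + 1)"
      using coeff_P_rec[of a b c d "int l' + 1" "int m + 1"] by (simp add: Suc add.commute)
    moreover have "coeff_R a b c d (int l + 1) (int m + 1) =
        Fin a * coeff_R a b c d (int l' + 1) (int m + 1) +
        Fin b * coeff_P d c b a (int m + 1) (int l' + 1)"
      using coeff_R_rec[of "int l' + 1" "int m + 1" a b c d] by (simp add: Suc add.commute)
    ultimately show ?thesis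
      by (simp only: mat_scale_add_left mult mat_scale_simps mult.commute add_ac)
  qed
  have Q: "Q ** decision P Q (Suc (l + m)) (int m - int l - 1) =
    coeff_P d c b a (int m + 1) (int l + 1) \<otimes>\<^sub>m Q + coeff_R d c b a (int m + 1) (int l + 1) \<otimes>\<^sub>m S"
  proof (cases m)
    case 0
    then have "int m - int l - 1 = - int (Suc l)"
      by simp
    then have "decision P Q (Suc (l + m)) (int m - int l - 1) = Fin (real l * a) \<otimes>\<^sub>m P"
      using decision_left[of a "Fin b" Q l] 0 by (simp only: P_def add_0_right)
    then show ?thesis
      using 0 by (simp add: mult coeff_one add.commute del: decision.simps)
  next
    case (Suc m')
    have "decision P Q (Suc (l + m)) (int m - int l - 1) = decision P Q (Suc l + Suc m') (int m' - int l)"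
      by (simp add: Suc del: decision.simps)
    also have "\<dots> =
        coeff_P a b c d (int l + 1) (int m' + 1) \<otimes>\<^sub>m P + coeff_P d c b a (int m' + 1) (int l + 1) \<otimes>\<^sub>m Q +
        coeff_R a b c d (int l + 1) (int m' + 1) \<otimes>\<^sub>m R + coeff_R d c b a (int m' + 1) (int l + 1) \<otimes>\<^sub>m S"
      by (rule less) (simp add: Suc)
    \<comment> \<open>The same recursions with left and right exchanged.\<close>
    moreover have "coeff_P d c b a (int m + 1) (int l + 1) =
        Fin d * coeff_P d c b a (int m' + 1) (int l + 1) +
        Fin c * coeff_R a b c d (int l + 1) (int m' + 1)"
      using coeff_P_rec[of d c b a "int m' + 1" "int l + 1"] by (simp add: Suc add.commute)
    moreover have "coeff_R d c b a (int m + 1) (int l + 1) =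
        Fin d * coeff_R d c b a (int m' + 1) (int l + 1) +
        Fin c * coeff_P a b c d (int l + 1) (int m' + 1)"
      using coeff_R_rec[of "int m' + 1" "int l + 1" d c b a] by (simp add: Suc add.commute)
    ultimately show ?thesis
      by (simp only: mat_scale_add_left mult mat_scale_simps mult.commute add_ac)
  qed
  have "decision P Q (Suc l + Suc m) (int m - int l) =
      P ** decision P Q (Suc (l + m)) (int m - int l + 1) +
      Q ** decision P Q (Suc (l + m)) (int m - int l - 1)"
    by (simp only: add_Suc add_Suc_right decision.simps(2))
  then show ?case
    unfolding P Q by (simp only: add_ac)
qed

theorem theorem3p1:
  fixes a b c d :: real and n :: nat and P Q R S :: "rmax ^ 2 ^ 2"
  assumes "n \<ge> 1"
    and "P = vector [vector [Fin a, Fin b], vector [\<epsilon>, \<epsilon>]]"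
    and "Q = vector [vector [\<epsilon>, \<epsilon>], vector [Fin c, Fin d]]"
    and "R = vector [vector [Fin c, Fin d], vector [\<epsilon>, \<epsilon>]]"
    and "S = vector [vector [\<epsilon>, \<epsilon>], vector [Fin a, Fin b]]"
  shows "decision P Q n (- int n) = Fin ((real n - 1) * a) \<otimes>\<^sub>m P \<and>
    decision P Q n (int n) = Fin ((real n - 1) * d) \<otimes>\<^sub>m Q \<and>
    (\<forall>k::int. - int n + 2 \<le> k \<and> k \<le> int n - 2 \<and> even (k + int n) \<longrightarrow>
      (let l = (int n - k) div 2; m = (int n + k) div 2 in
        decision P Q n k =
          (\<Sum>r = 1..min (l - 1) m.
             Fin (of_int (l - r - 1) * a + of_int r * b + of_int r * c + of_int (m - r) * d) \<otimes>\<^sub>m P)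
        + (\<Sum>r = 1..min l (m - 1).
             Fin (of_int (l - r) * a + of_int r * b + of_int r * c + of_int (m - r - 1) * d) \<otimes>\<^sub>m Q)
        + (\<Sum>r = 1..min l m.
             Fin (of_int (l - r) * a + of_int r * b + of_int (r - 1) * c + of_int (m - r) * d) \<otimes>\<^sub>m R)
        + (\<Sum>r = 1..min l m.
             Fin (of_int (l - r) * a + of_int (r - 1) * b + of_int r * c + of_int (m - r) * d) \<otimes>\<^sub>m S)))"
proof -
  have P: "P = top_row (Fin a) (Fin b)" and Q: "Q = bottom_row (Fin c) (Fin d)"
    and R: "R = top_row (Fin c) (Fin d)" and S: "S = bottom_row (Fin a) (Fin b)"
    using assms by (simp_all add: top_row_def bottom_row_def)
  obtain n' where n': "n = Suc n'"
    using assms(1) by (cases n) auto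
  have "decision P Q n k =
      (\<Sum>r = 1..min (l - 1) m.
         Fin (of_int (l - r - 1) * a + of_int r * b + of_int r * c + of_int (m - r) * d) \<otimes>\<^sub>m P)
    + (\<Sum>r = 1..min l (m - 1).
         Fin (of_int (l - r) * a + of_int r * b + of_int r * c + of_int (m - r - 1) * d) \<otimes>\<^sub>m Q)
    + (\<Sum>r = 1..min l m.
         Fin (of_int (l - r) * a + of_int r * b + of_int (r - 1) * c + of_int (m - r) * d) \<otimes>\<^sub>m R)
    + (\<Sum>r = 1..min l m.
         Fin (of_int (l - r) * a + of_int (r - 1) * b + of_int r * c + of_int (m - r) * d) \<otimes>\<^sub>m S)"
    if k: "- int n + 2 \<le> k" "k \<le> int n - 2" "even (k + int n)"
      and lm: "l = (int n - k) div 2" "m = (int n + k) div 2" for k l m :: int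
  proof -
    \<comment> \<open>Parity makes both divisions exact, and the bounds on \<open>k\<close> leave at
      least one move of each kind.\<close>
    have "l \<ge> 1" "m \<ge> 1" and sum: "l + m = int n" and diff: "m - l = k"
      using k lm by presburger+
    then obtain i j :: nat where ij: "l = int i + 1" "m = int j + 1"
      by (metis add.commute zle_iff_zadd)
    then have n: "n = Suc i + Suc j" and k': "k = int j - int i"
      using sum diff by linarith+
    \<comment> \<open>The mirrored coefficients agree with the displayed sums after reordering the
      real summands.\<close>
    have coeff_Q: "coeff_P d c b a m l = (\<Sum>r = 1..min l (m - 1).
        Fin (of_int (l - r) * a + of_int r * b + of_int r * c + of_int (m - r - 1) * d))"
      unfolding coeff_P_def by (intro sum.cong) (auto simp: min.commute algebra_simps)
    have coeff_S: "coeff_R d c b a m l = (\<Sum>r = 1..min l m.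
        Fin (of_int (l - r) * a + of_int (r - 1) * b + of_int r * c + of_int (m - r) * d))"
      unfolding coeff_R_def by (intro sum.cong) (auto simp: min.commute algebra_simps)
    have "decision P Q n k = coeff_P a b c d l m \<otimes>\<^sub>m P + coeff_P d c b a m l \<otimes>\<^sub>m Q +
        coeff_R a b c d l m \<otimes>\<^sub>m R + coeff_R d c b a m l \<otimes>\<^sub>m S"
      unfolding n k' ij P Q R S by (rule decision_interior)
    then show ?thesis
      unfolding coeff_Q coeff_S by (simp only: coeff_P_def coeff_R_def mat_scale_sum_left)
  qed
  moreover have "decision P Q n (- int n) = Fin ((real n - 1) * a) \<otimes>\<^sub>m P"
    using decision_left[of a "Fin b" Q n'] by (simp add: n' P del: decision.simps)
  moreover have "decision P Q n (int n) = Fin ((real n - 1) * d) \<otimes>\<^sub>m Q"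
    using decision_right[of P "Fin c" d n'] by (simp add: n' Q del: decision.simps)
  ultimately show ?thesis
    unfolding Let_def by blast
qed

end
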